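(* Let $n\ge 1$ and let $G$ be a real $n\times n$ matrix that is positive-definite up to permutations of its rows and columns, i.e., there exist $n\times n$ permutation matrices $P,Q$ such that $PGQ$ is (symmetric) positive-definite. Then $\mathrm{IRGA}(G)=\left(G\circ (G^{-1})^T\right)^{-1}$ is well defined and is again positive-definite up to permutations of its rows and columns, and every row sum and every column sum of $\mathrm{IRGA}(G)$ equals $1$. Moreover, if $n\le 4$, then every entry of $\mathrm{IRGA}(G)$ is nonnegative, so $\mathrm{IRGA}(G)$ is doubly-stochastic (and, up to row and column permutations, doubly nonnegative).
   Context: For matrices $A,B$ of the same size, $A\circ B$ denotes the entrywise (Hadamard) product. For a nonsingular matrix $G$, the relative gain array is $\mathrm{RGA}(G)=G\circ (G^{-1})^T$ (plain transpose of the inverse), and the inverse relative gain array is $\mathrm{IRGA}(G)=\left(\mathrm{RGA}(G)\right)^{-1}$. A real matrix is positive-definite if it is symmetric and $x^TMx>0$ for all nonzero real vectors $x$. A matrix is doubly-stochastic if all its entries are nonnegative and every row and column sums to $1$; a matrix is doubly nonnegative if it is symmetric positive-definite (semidefinite) with all entries nonnegative. *)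

theory Defs
  imports "HOL-Analysis.Analysis"
begin

(* "*" on vectors is componentwise multiplication, hence on matrices it is the Hadamard product
   (the matrix product is "**"). *)
definition RGA :: "real^'n^'n \<Rightarrow> real^'n^'n" where
  "RGA G = G * transpose (matrix_inv G)"

definition IRGA :: "real^'n^'n \<Rightarrow> real^'n^'n" where
  "IRGA G = matrix_inv (RGA G)"

definition positive_definite :: "real^'n^'n \<Rightarrow> bool" where
  "positive_definite M \<longleftrightarrow> transpose M = M \<and> (\<forall>x. x \<noteq> 0 \<longrightarrow> x \<bullet> (M *v x) > 0)"

definition permutation_matrix :: "real^'n^'n \<Rightarrow> bool" where
  "permutation_matrix P \<longleftrightarrow>
     (\<exists>\<pi>. \<pi> permutes UNIV \<and> P = (\<chi> i j. if j = \<pi> i then 1 else 0))"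

definition up_to_permutations :: "(real^'n^'n \<Rightarrow> bool) \<Rightarrow> real^'n^'n \<Rightarrow> bool" where
  "up_to_permutations \<Phi> M \<longleftrightarrow>
     (\<exists>P Q. permutation_matrix P \<and> permutation_matrix Q \<and> \<Phi> (P ** M ** Q))"

definition entrywise_nonneg :: "real^'n^'n \<Rightarrow> bool" where
  "entrywise_nonneg M \<longleftrightarrow> (\<forall>i j. M $ i $ j \<ge> 0)"

definition unit_row_sums :: "real^'n^'n \<Rightarrow> bool" where
  "unit_row_sums M \<longleftrightarrow> (\<forall>i. (\<Sum>j\<in>UNIV. M $ i $ j) = 1)"

definition unit_col_sums :: "real^'n^'n \<Rightarrow> bool" where
  "unit_col_sums M \<longleftrightarrow> (\<forall>j. (\<Sum>i\<in>UNIV. M $ i $ j) = 1)"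

definition doubly_stochastic :: "real^'n^'n \<Rightarrow> bool" where
  "doubly_stochastic M \<longleftrightarrow> entrywise_nonneg M \<and> unit_row_sums M \<and> unit_col_sums M"

(* The term is often used with "semidefinite" in place of "definite"; the condition below
   implies that variant. *)
definition doubly_nonnegative :: "real^'n^'n \<Rightarrow> bool" where
  "doubly_nonnegative M \<longleftrightarrow> positive_definite M \<and> entrywise_nonneg M"

end

theory Submission
  imports Defs
begin

text \<open>Row and column permutations commute with the relative gain array, so let \<open>M\<close> be positive
  definite. Then \<open>A = RGA M\<close> is the Hadamard product of the positive definite matrices \<open>M\<close> and
  its inverse, hence positive definite by Schur's theorem, and its row sums are the diagonal
  entries of \<open>M ** matrix_inv M\<close>. For the sign of the entries of the inverse of \<open>A\<close>, sizes below 4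
  reduce to size 4 by adding an identity block. In size 4, the sign of the off-diagonal entry at
  \<open>(1, 2)\<close> is that of a 3-by-3 cofactor of \<open>A\<close>. Parametrising the pair of \<open>M\<close> and its inverse by
  block elimination along \<open>{1, 2}\<close> and \<open>{3, 4}\<close> leaves two correlations \<open>k, s\<close> in \<open>(-1, 1)\<close> and an
  unconstrained 2-by-2 matrix \<open>(b1, b2; b3, b4)\<close>; in these coordinates the cofactor is a positive
  multiple of a polynomial with an explicit certificate as a sum of squares whose coefficients
  are nonnegative for all \<open>k, s\<close> in that range.\<close>

section \<open>Positive definite matrices\<close>

lemma inner_matrix_vector_mult:
  fixes M :: "real^'n^'n"
  shows "x \<bullet> (M *v y) = (\<Sum>i\<in>UNIV. \<Sum>j\<in>UNIV. M$i$j * x$i * y$j)"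
  by (simp add: inner_vec_def matrix_vector_mult_def sum_distrib_left mult_ac)

lemma positive_definite_sym:
  "positive_definite M \<Longrightarrow> M$i$j = M$j$i"
  unfolding positive_definite_def by (metis transpose_def vec_lambda_beta)

lemma positive_definite_invertible:
  assumes "positive_definite M"
  shows "invertible M"
  unfolding invertible_left_inverse matrix_left_invertible_ker
proof safe
  fix x assume "M *v x = 0"
  then have "x \<bullet> (M *v x) = 0" by simp
  then show "x = 0" using assms unfolding positive_definite_def by force
qed

lemma matrix_inv_mult:
  fixes M :: "real^'n^'n"
  assumes "invertible M"
  shows "matrix_inv M ** M = mat 1" "M ** matrix_inv M = mat 1"
  using assms someI_ex[of "\<lambda>N. M ** N = mat 1 \<and> N ** M = mat 1"]
  unfolding matrix_inv_def invertible_def by auto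

lemma matrix_inv_eq:
  fixes M N :: "real^'n^'n"
  assumes "M ** N = mat 1"
  shows "matrix_inv M = N"
proof -
  have "invertible M" using assms invertible_right_inverse by blast
  then show ?thesis
    by (metis assms matrix_inv_mult(1) matrix_mul_assoc matrix_mul_lid matrix_mul_rid)
qed

text \<open>By symmetry of \<open>M\<close>, the transpose of its inverse is again a right inverse.
  Substituting \<open>x = M *v (?N *v x)\<close> turns the form of the inverse into that of
  \<open>M\<close>.\<close>

lemma positive_definite_matrix_inv:
  fixes M :: "real^'n^'n"
  assumes "positive_definite M"
  shows "positive_definite (matrix_inv M)"
  unfolding positive_definite_def
proof (intro conjI allI impI)
  let ?N = "matrix_inv M"
  note inv = matrix_inv_mult[OF positive_definite_invertible[OF assms]]
  have "M ** transpose ?N = transpose (?N ** transpose (transpose (transpose M)))"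
    using assms by (simp add: matrix_transpose_mul positive_definite_def)
  also have "\<dots> = mat 1"
    using assms by (simp add: inv positive_definite_def transpose_mat)
  finally show "transpose ?N = ?N" using matrix_inv_eq by metis
  fix x :: "real^'n" assume "x \<noteq> 0"
  have x: "M *v (?N *v x) = x" by (simp add: matrix_vector_mul_assoc inv)
  with \<open>x \<noteq> 0\<close> have "?N *v x \<noteq> 0" by auto
  then have "0 < (?N *v x) \<bullet> (M *v (?N *v x))" using assms unfolding positive_definite_def by blast
  then show "0 < x \<bullet> (?N *v x)" by (simp add: x inner_commute)
qed

lemma positive_definite_diag_pos:
  assumes "positive_definite M"
  shows "0 < M$i$i"
proof -
  have "0 < axis i 1 \<bullet> (M *v axis i 1)"
    using assms unfolding positive_definite_def by (simp add: axis_eq_0_iff)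
  then show ?thesis
    by (simp add: matrix_vector_mult_basis column_def inner_axis')
qed

lemma positive_definite_minor_pos:
  fixes M :: "real^'n^'n"
  assumes "positive_definite M" "i \<noteq> j"
  shows "(M$i$j)^2 < M$i$i * M$j$j"
proof -
  \<comment> \<open>Up to the factor \<open>M$j$j\<close>, this minimises the form of
    \<open>M\<close> on the line through \<open>axis i 1\<close> in the direction
    \<open>axis j 1\<close>.\<close>
  let ?x = "M$j$j *\<^sub>R axis i 1 - M$i$j *\<^sub>R axis j 1 :: real^'n"
  have "?x $ i \<noteq> 0" using positive_definite_diag_pos[OF assms(1), of j] assms(2) by (simp add: axis_def)
  then have "?x \<noteq> 0" by (metis zero_index)
  then have "0 < ?x \<bullet> (M *v ?x)" using assms unfolding positive_definite_def by blast
  also have "?x \<bullet> (M *v ?x) = M$j$j * (M$i$i * M$j$j - (M$i$j)^2)"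
    using positive_definite_sym[OF assms(1), of j i]
    by (simp add: matrix_vector_mult_diff_distrib matrix_vector_mult_scaleR inner_diff_left inner_axis'
        matrix_vector_mult_basis column_def power2_eq_square algebra_simps)
  finally show ?thesis using positive_definite_diag_pos[OF assms(1), of j] by (simp add: zero_less_mult_iff)
qed

text \<open>Cholesky elimination on one index at a time.\<close>
lemma positive_form_gram:
  fixes M :: "'a \<Rightarrow> 'a \<Rightarrow> real"
  assumes "finite I" and "\<And>i j. M i j = M j i"
    and "\<And>x. \<exists>i\<in>I. x i \<noteq> 0 \<Longrightarrow> 0 < (\<Sum>i\<in>I. \<Sum>j\<in>I. M i j * x i * x j)"
  shows "\<exists>C. \<forall>i\<in>I. \<forall>j\<in>I. M i j = (\<Sum>a\<in>I. C a i * C a j)"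
  using assms
proof (induction I arbitrary: M rule: finite_induct)
  case empty
  then show ?case by simp
next
  case (insert p I)
  note sym = insert.prems(1)
  have expand: "(\<Sum>i\<in>insert p I. \<Sum>j\<in>insert p I. M i j * x i * x j)
      = M p p * (x p)^2 + 2 * x p * (\<Sum>j\<in>I. M p j * x j) + (\<Sum>i\<in>I. \<Sum>j\<in>I. M i j * x i * x j)" for x
  proof -
    have "(\<Sum>i\<in>I. M i p * x i * x p) = x p * (\<Sum>j\<in>I. M p j * x j)"
      by (simp add: sum_distrib_left sym[of _ p] mult_ac)
    moreover have "(\<Sum>j\<in>I. M p j * x p * x j) = x p * (\<Sum>j\<in>I. M p j * x j)"
      by (simp add: sum_distrib_left mult_ac)
    ultimately show ?thesis
      using insert.hyps by (simp add: sum.distrib power2_eq_square algebra_simps)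
  qed
  have pp: "0 < M p p"
  proof -
    let ?e = "\<lambda>i. if i = p then 1 else (0 :: real)"
    have "(\<Sum>j\<in>I. M p j * ?e j) = 0" "(\<Sum>i\<in>I. \<Sum>j\<in>I. M i j * ?e i * ?e j) = 0"
      using insert.hyps by (auto intro!: sum.neutral)
    then show ?thesis
      using insert.prems(2)[of ?e] unfolding expand by simp
  qed
  \<comment> \<open>The Schur complement of the pivot \<open>M p p\<close>.\<close>
  define M' where "M' i j = M i j - M p i * M p j / M p p" for i j
  have "\<exists>C. \<forall>i\<in>I. \<forall>j\<in>I. M' i j = (\<Sum>a\<in>I. C a i * C a j)"
  proof (rule insert.IH)
    show "M' i j = M' j i" for i j by (simp add: M'_def sym[of i j])
    fix x :: "'a \<Rightarrow> real" assume x: "\<exists>i\<in>I. x i \<noteq> 0"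
    define L where "L = (\<Sum>j\<in>I. M p j * x j)"
    \<comment> \<open>With \<open>x\<close> fixed on \<open>I\<close>, this value at
      \<open>p\<close> minimises the form on \<open>insert p I\<close>; the minimum is the form of
      \<open>M'\<close>.\<close>
    define y where "y = x(p := - L / M p p)"
    have y: "y j = x j" if "j \<in> I" for j using that insert.hyps by (auto simp: y_def)
    have "0 < (\<Sum>i\<in>insert p I. \<Sum>j\<in>insert p I. M i j * y i * y j)"
      using x y by (intro insert.prems(2)) auto
    also have "\<dots> = (\<Sum>i\<in>I. \<Sum>j\<in>I. M i j * x i * x j) - L^2 / M p p"
      unfolding expand using pp
      by (simp add: y L_def[symmetric] cong: sum.cong) (simp add: y_def power2_eq_square field_simps)
    also have "L^2 = (\<Sum>i\<in>I. \<Sum>j\<in>I. M p i * M p j * x i * x j)"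
      by (simp add: L_def power2_eq_square sum_product mult_ac)
    finally show "0 < (\<Sum>i\<in>I. \<Sum>j\<in>I. M' i j * x i * x j)"
      by (simp add: M'_def left_diff_distrib sum_subtractf sum_divide_distrib)
  qed
  then obtain C' where C': "\<And>i j. i \<in> I \<Longrightarrow> j \<in> I \<Longrightarrow> M' i j = (\<Sum>a\<in>I. C' a i * C' a j)"
    by blast
  \<comment> \<open>The factor of the Schur complement, bordered by the scaled pivot row; the other
    rows vanish in column \<open>p\<close>.\<close>
  define C where "C a i = (if a = p then M p i / sqrt (M p p) else if i = p then 0 else C' a i)" for a i
  have C_I: "(\<Sum>a\<in>I. C a i * C a j) = (if i = p \<or> j = p then 0 else (\<Sum>a\<in>I. C' a i * C' a j))" for i j
    using insert.hyps(2) by (auto simp: C_def intro!: sum.neutral sum.cong)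
  have "M i j = (\<Sum>a\<in>insert p I. C a i * C a j)" if "i \<in> insert p I" "j \<in> insert p I" for i j
  proof -
    have "(\<Sum>a\<in>insert p I. C a i * C a j) = M p i * M p j / M p p + (\<Sum>a\<in>I. C a i * C a j)"
      using insert.hyps pp by (simp add: C_def)
    also have "\<dots> = M i j"
      using that pp C'[of i j] by (auto simp: C_I M'_def sym[of i p])
    finally show ?thesis by simp
  qed
  then show ?case by blast
qed

text \<open>A Gram factorisation \<open>C\<close> of \<open>N\<close> splits the form of
  \<open>M * N\<close> at \<open>x\<close> into a sum of forms of \<open>M\<close> at the vectors
  \<open>y a\<close>, the rows of \<open>C\<close> times \<open>x\<close> entrywise. If
  \<open>x $ p\<close> is nonzero, \<open>N$p$p > 0\<close> makes some \<open>C a p\<close>, and so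
  \<open>y a\<close>, nonzero.\<close>

theorem schur_product:
  fixes M N :: "real^'n^'n"
  assumes M: "positive_definite M" and N: "positive_definite N"
  shows "positive_definite (M * N)"
  unfolding positive_definite_def
proof (intro conjI allI impI)
  show "transpose (M * N) = M * N"
    using positive_definite_sym[OF M] positive_definite_sym[OF N]
    by (simp add: transpose_def vec_eq_iff)
  fix x :: "real^'n" assume "x \<noteq> 0"
  then obtain p where p: "x $ p \<noteq> 0" by (auto simp: vec_eq_iff)
  have "0 < (\<Sum>i\<in>UNIV. \<Sum>j\<in>UNIV. N$i$j * y i * y j)" if "\<exists>i\<in>UNIV. y i \<noteq> 0" for y
  proof -
    have "(\<chi> i. y i) \<noteq> 0" using that by (auto simp: vec_eq_iff)
    then have "0 < (\<chi> i. y i) \<bullet> (N *v (\<chi> i. y i))" using N unfolding positive_definite_def by blast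
    then show ?thesis by (simp add: inner_matrix_vector_mult)
  qed
  then have "\<exists>C. \<forall>i\<in>UNIV. \<forall>j\<in>UNIV. N$i$j = (\<Sum>a\<in>(UNIV :: 'n set). C a i * C a j)"
    using positive_definite_sym[OF N] by (intro positive_form_gram) auto
  then obtain C where C: "\<And>i j. N$i$j = (\<Sum>a\<in>(UNIV :: 'n set). C a i * C a j)"
    by blast
  define y :: "'n \<Rightarrow> real^'n" where "y a = (\<chi> i. C a i * x$i)" for a
  have "x \<bullet> (M * N *v x) = (\<Sum>i\<in>UNIV. \<Sum>j\<in>UNIV. \<Sum>a\<in>UNIV. M$i$j * y a$i * y a$j)"
    by (simp add: inner_matrix_vector_mult C y_def sum_distrib_left sum_distrib_right mult_ac)
  also have "\<dots> = (\<Sum>i\<in>UNIV. \<Sum>a\<in>UNIV. \<Sum>j\<in>UNIV. M$i$j * y a$i * y a$j)"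
    by (intro sum.cong refl sum.swap)
  also have "\<dots> = (\<Sum>a\<in>UNIV. y a \<bullet> (M *v y a))"
    by (subst sum.swap) (simp add: inner_matrix_vector_mult)
  also have "\<dots> > 0"
  proof -
    have nonneg: "0 \<le> y a \<bullet> (M *v y a)" for a
      using M unfolding positive_definite_def by (cases "y a = 0") (auto intro: less_imp_le)
    have "\<exists>a. C a p \<noteq> 0"
      using C[of p p] positive_definite_diag_pos[OF N, of p] by (auto intro: ccontr)
    then obtain a where "C a p \<noteq> 0" by blast
    then have "y a \<noteq> 0" using p by (auto simp: y_def vec_eq_iff)
    then have "0 < y a \<bullet> (M *v y a)" using M unfolding positive_definite_def by blast
    then show ?thesis using nonneg by (intro sum_pos2[of UNIV a]) auto
  qed
  finally show "0 < x \<bullet> (M * N *v x)" .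
qed

section \<open>The cofactor inequality in size 4\<close>

lemma binary_quadratic_form_nonneg:
  fixes a b c x y :: real
  assumes "0 < a" and "b^2 \<le> 4 * a * c"
  shows "0 \<le> a * x^2 + b * x * y + c * y^2"
proof -
  have "4 * a * (a * x^2 + b * x * y + c * y^2) = (2 * a * x + b * y)^2 + (4 * a * c - b^2) * y^2"
    by (simp add: power2_eq_square algebra_simps)
  also have "\<dots> \<ge> 0" using assms by simp
  finally show ?thesis using assms(1) by (simp add: zero_le_mult_iff)
qed

text \<open>Since \<open>1 + e * s^3 = (1 + e * s) * t\<close> and
  \<open>1 - s^2 = (1 + e * s) * (1 - e * s)\<close>, the discriminant condition reduces to
  \<open>(1 - e * s)^2 \<le> 4 * t\<close>.\<close>

lemma odd_block_nonneg:
  fixes e h k s x y :: real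
  assumes k: "k^2 < 1" and s: "s^2 < 1" and "e^2 = 1" "h^2 = 1"
  shows "0 \<le> (1 - k^2) * (1 - h * k) * (k^2 * (1 + e * s^3) * x^2
    + h * k * (1 - s^2)^2 * x * y + (1 - s^2)^2 * (1 + e * s) * y^2)"
proof -
  have s1: "-1 < s" "s < 1" and k1: "-1 < k" "k < 1"
    using abs_square_less_1[of s] abs_square_less_1[of k] s k by auto
  have e: "e = 1 \<or> e = -1" and h: "h = 1 \<or> h = -1"
    using assms by (auto simp: power2_eq_1_iff)
  have hk: "0 < 1 - h * k" and es: "0 < 1 + e * s" using h e s1 k1 by auto
  define t where "t = 1 - e * s + s^2"
  have t: "(1 + e * s^3) = (1 + e * s) * t"
    using e by (auto simp: t_def power2_eq_square power3_eq_cube algebra_simps)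
  have t': "4 * t - (1 - e * s)^2 = 2 + 2 * s^2 + (1 - e * s)^2"
    using e by (auto simp: t_def power2_eq_square algebra_simps)
  have fac: "1 - s^2 = (1 + e * s) * (1 - e * s)"
    using e by (auto simp: power2_eq_square algebra_simps)
  have "0 \<le> k^2 * (1 + e * s^3) * x^2
    + h * k * (1 - s^2)^2 * x * y + (1 - s^2)^2 * (1 + e * s) * y^2"
  \<comment> \<open>At \<open>k = 0\<close> the coefficient of \<open>x^2\<close> vanishes, so the
    discriminant criterion does not apply.\<close>
  proof (cases "k = 0")
    case True
    then show ?thesis using es by simp
  next
    case False
    have tpos: "0 < t" using t' by (smt (verit) zero_le_power2)
    show ?thesis
    proof (rule binary_quadratic_form_nonneg)
      show "0 < k^2 * (1 + e * s^3)" using t tpos es False by simp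
      have "(1 - e * s)^2 \<le> 4 * t" using t' by (smt (verit) zero_le_power2)
      then have "k^2 * (1 - s^2)^2 * (1 + e * s)^2 * (1 - e * s)^2
         \<le> k^2 * (1 - s^2)^2 * (1 + e * s)^2 * (4 * t)"
        by (intro mult_left_mono) auto
      moreover have "(h * k * (1 - s^2)^2)^2 = k^2 * (1 - s^2)^2 * (1 + e * s)^2 * (1 - e * s)^2"
        using assms(4) fac by algebra
      moreover have "4 * (k^2 * (1 + e * s^3)) * ((1 - s^2)^2 * (1 + e * s))
          = k^2 * (1 - s^2)^2 * (1 + e * s)^2 * (4 * t)"
        unfolding t by algebra
      ultimately show "(h * k * (1 - s^2)^2)^2
          \<le> 4 * (k^2 * (1 + e * s^3)) * ((1 - s^2)^2 * (1 + e * s))"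
        by (simp only:)
    qed
  qed
  then show ?thesis using hk k by simp
qed

text \<open>The certificate comes from the symmetry of the polynomial under swapping the rows
  and the columns of the matrix \<open>(b1, b2; b3, b4)\<close>. It block-diagonalises a sum-of-squares
  representation over the monomials of even degree \<open>1, b1 b2, \<dots>\<close> and of odd degree
  \<open>b1, \<dots>, b2 b3 b4, \<dots>\<close>; the odd part splits along the four characters \<open>(e, h)\<close> of the
  symmetry group into binary forms in \<open>B e h\<close> and \<open>X e h\<close>.\<close>
lemma cofactor_polynomial_nonneg:
  fixes k s b1 b2 b3 b4 :: real
  assumes k: "k^2 < 1" and s: "s^2 < 1"
    and dl: "\<delta> = 1 - k^2" and sg: "\<sigma> = 1 - s^2"
    and A33: "A33 = \<delta> + \<sigma> * (b1^2 - 2*k*b1*b3 + b3^2)"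
    and A44: "A44 = \<delta> + \<sigma> * (b2^2 - 2*k*b2*b4 + b4^2)"
    and A34: "A34 = s * (\<sigma> * (b1*b2 - k*(b1*b4 + b2*b3) + b3*b4) - s * \<delta>)"
    and g13: "g13 = (b1 + s*b2) * (b1 - k*b3)" and g14: "g14 = (b2 + s*b1) * (b2 - k*b4)"
    and g23: "g23 = (b3 + s*b4) * (b3 - k*b1)" and g24: "g24 = (b4 + s*b3) * (b4 - k*b2)"
  shows "0 \<le> k * (k + b1*b3 + s*(b1*b4 + b2*b3) + b2*b4) * (A33 * A44 - A34^2)
    + \<sigma> * (g13*g23*A44 + g14*g24*A33 - A34*(g13*g24 + g14*g23))"
    (is "0 \<le> ?p")
proof -
  \<comment> \<open>The \<open>u\<close> are invariant under both swaps; \<open>v2\<close> changes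
    sign under the column swap only, \<open>v3\<close> under each swap.\<close>
  define u1 u2 u3 v2 v3 where "u1 = b1*b2 + b3*b4" and "u2 = b1*b3 + b2*b4"
    and "u3 = b1*b4 + b2*b3" and "v2 = b1*b3 - b2*b4" and "v3 = b1*b4 - b2*b3"
  \<comment> \<open>The column swap multiplies both forms by \<open>e\<close>, the row swap by
    \<open>h\<close>.\<close>
  define B X where "B e h = b1 + e*b2 + h*b3 + e*h*b4"
    and "X e h = b2*b3*b4 + e*(b1*b3*b4) + h*(b1*b2*b4) + e*h*(b1*b2*b3)" for e h :: real
  define blk where "blk e h = (1 - k^2) * (1 - h*k) * (k^2 * (1 + e * s^3) * (B e h)^2
    + h*k*(1 - s^2)^2 * B e h * X e h + (1 - s^2)^2 * (1 + e * s) * (X e h)^2)" for e h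
  have blk: "0 \<le> blk 1 1" "0 \<le> blk 1 (-1)" "0 \<le> blk (-1) 1" "0 \<le> blk (-1) (-1)"
    unfolding blk_def by (rule odd_block_nonneg[OF k s]; simp)+
  have "4 * ?p = \<sigma> * (\<delta>^2 * (1 + s^2) * (2*k + u2 + s*u3)^2 + \<delta>^2 * (1 + s^2) * (u2 + s*u3)^2
      + 4 * k^2 * \<sigma>^2 * (u1 - k*u3)^2 + 2 * \<delta>^2 * \<sigma> * v2^2
      + (2 * s^2 * \<delta>^2 * \<sigma> + 4 * k^2 * \<sigma> * \<delta> * (1 + s^2)) * v3^2
      + blk 1 1 + blk 1 (-1) + blk (-1) 1 + blk (-1) (-1))"
    unfolding blk_def B_def X_def u1_def u2_def u3_def v2_def v3_def dl sg A33 A44 A34 g13 g14 g23 g24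
    by algebra
  also have "\<dots> \<ge> 0"
    using blk k s dl sg by (intro add_nonneg_nonneg mult_nonneg_nonneg) auto
  finally show ?thesis by simp
qed

text \<open>Block elimination: with \<open>S\<close> the block of \<open>M\<close> on \<open>i3, i4\<close> and \<open>K\<close> the inverse of
  the block of \<open>N\<close> on \<open>i1, i2\<close>, one has \<open>M = (K + B S B\<^sup>T, B S; S B\<^sup>T, S)\<close> and
  \<open>N = (K\<^sup>-\<^sup>1, - K\<^sup>-\<^sup>1 B; - B\<^sup>T K\<^sup>-\<^sup>1, S\<^sup>-\<^sup>1 + B\<^sup>T K\<^sup>-\<^sup>1 B)\<close> for an arbitrary matrix \<open>B\<close>.
  The normalisation makes \<open>K = (1, k; k, 1)\<close> and \<open>S = (1, s; s, 1)\<close>.\<close>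
lemma normalised_cofactor_nonneg:
  fixes M N :: "real^'n^'n" and i1 i2 i3 i4 :: 'n
  defines "A \<equiv> M * N"
  assumes U: "UNIV = {i1, i2, i3, i4}" and dist: "distinct [i1, i2, i3, i4]"
    and sym: "transpose M = M" "transpose N = N" and NM: "N ** M = mat 1"
    and k: "k^2 < 1" and s: "(M$i3$i4)^2 < 1"
    and n: "(1 - k^2) * N$i1$i1 = 1" "(1 - k^2) * N$i2$i2 = 1" "(1 - k^2) * N$i1$i2 = - k"
    and m: "M$i3$i3 = 1" "M$i4$i4 = 1"
  shows "0 \<le> - A$i1$i2 * (A$i3$i3 * A$i4$i4 - (A$i3$i4)^2)
    + A$i1$i3 * A$i2$i3 * A$i4$i4 + A$i1$i4 * A$i2$i4 * A$i3$i3
    - A$i3$i4 * (A$i1$i3 * A$i2$i4 + A$i1$i4 * A$i2$i3)"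
    (is "0 \<le> ?C")
proof -
  have symM: "M$p$q = M$q$p" and symN: "N$p$q = N$q$p" for p q
    using sym by (metis transpose_def vec_lambda_beta)+
  have eq: "N$p$i1 * M$i1$q + N$p$i2 * M$i2$q + N$p$i3 * M$i3$q + N$p$i4 * M$i4$q
      = (if p = q then 1 else 0)" for p q
  proof -
    have "(N ** M)$p$q = N$p$i1 * M$i1$q + N$p$i2 * M$i2$q + N$p$i3 * M$i3$q + N$p$i4 * M$i4$q"
      using dist by (simp add: matrix_matrix_mult_def U)
    then show ?thesis by (simp add: NM mat_def)
  qed
  define s where "s = M$i3$i4"
  define \<delta> where "\<delta> = 1 - k^2"
  define \<sigma> where "\<sigma> = 1 - s^2"
  have pos: "0 < \<delta>" "0 < \<sigma>" using k s by (auto simp: \<delta>_def \<sigma>_def s_def)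
  define m12 m22 where ms: "m12 = M$i1$i2" "m22 = M$i2$i2"
  define n11 n12 n13 n14 n22 n23 n24 n33 n34 n44 where
    ns: "n11 = N$i1$i1" "n12 = N$i1$i2" "n13 = N$i1$i3" "n14 = N$i1$i4" "n22 = N$i2$i2"
      "n23 = N$i2$i3" "n24 = N$i2$i4" "n33 = N$i3$i3" "n34 = N$i3$i4" "n44 = N$i4$i4"
  \<comment> \<open>The matrix B is the off-diagonal block of \<open>M\<close> times the inverse
    \<open>(1, -s; -s, 1) / \<sigma>\<close> of S.\<close>
  define b1 b2 b3 b4 where "b1 = (M$i1$i3 - s * M$i1$i4) / \<sigma>" and "b2 = (M$i1$i4 - s * M$i1$i3) / \<sigma>"
    and "b3 = (M$i2$i3 - s * M$i2$i4) / \<sigma>" and "b4 = (M$i2$i4 - s * M$i2$i3) / \<sigma>"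
  then have b: "\<sigma> * b1 = M$i1$i3 - s * M$i1$i4" "\<sigma> * b2 = M$i1$i4 - s * M$i1$i3"
      "\<sigma> * b3 = M$i2$i3 - s * M$i2$i4" "\<sigma> * b4 = M$i2$i4 - s * M$i2$i3"
    using pos by simp_all
  have "\<sigma> * (M$i1$i3 - (b1 + s*b2)) = 0" "\<sigma> * (M$i1$i4 - (b2 + s*b1)) = 0"
      "\<sigma> * (M$i2$i3 - (b3 + s*b4)) = 0" "\<sigma> * (M$i2$i4 - (b4 + s*b3)) = 0"
    using b \<sigma>_def by algebra+
  then have mb: "M$i1$i3 = b1 + s*b2" "M$i1$i4 = b2 + s*b1" "M$i2$i3 = b3 + s*b4" "M$i2$i4 = b4 + s*b3"
    using pos by auto
  have n': "\<delta> * n11 = 1" "\<delta> * n22 = 1" "\<delta> * n12 = - k"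
    using n by (simp_all add: \<delta>_def ns)
  have sN: "N$i2$i1 = n12" "N$i3$i1 = n13" "N$i3$i2 = n23" "N$i4$i1 = n14" "N$i4$i2 = n24" "N$i4$i3 = n34"
    and sM: "M$i3$i1 = b1 + s*b2" "M$i4$i1 = b2 + s*b1" "M$i3$i2 = b3 + s*b4" "M$i4$i2 = b4 + s*b3" "M$i4$i3 = s"
      "M$i2$i1 = m12"
    using symN symM mb by (simp_all add: ns s_def ms)
  note ents = sN sM mb m ns[symmetric] ms[symmetric] s_def[symmetric]
  have d: "i1 \<noteq> i2" "i1 \<noteq> i3" "i1 \<noteq> i4" "i2 \<noteq> i3" "i2 \<noteq> i4" "i3 \<noteq> i4" using dist by auto
  have e13: "n11 * (b1 + s*b2) + n12 * (b3 + s*b4) + n13 + n14 * s = 0"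
    and e14: "n11 * (b2 + s*b1) + n12 * (b4 + s*b3) + n13 * s + n14 = 0"
    and e23: "n12 * (b1 + s*b2) + n22 * (b3 + s*b4) + n23 + n24 * s = 0"
    and e24: "n12 * (b2 + s*b1) + n22 * (b4 + s*b3) + n23 * s + n24 = 0"
    and e12: "n11 * m12 + n12 * m22 + n13 * (b3 + s*b4) + n14 * (b4 + s*b3) = 0"
    and e22: "n12 * m12 + n22 * m22 + n23 * (b3 + s*b4) + n24 * (b4 + s*b3) = 1"
    and e33: "n13 * (b1 + s*b2) + n23 * (b3 + s*b4) + n33 + n34 * s = 1"
    and e34: "n13 * (b2 + s*b1) + n23 * (b4 + s*b3) + n33 * s + n34 = 0"
    and e43: "n14 * (b1 + s*b2) + n24 * (b3 + s*b4) + n34 + n44 * s = 0"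
    and e44: "n14 * (b2 + s*b1) + n24 * (b4 + s*b3) + n34 * s + n44 = 1"
    using eq[of i1 i3] eq[of i1 i4] eq[of i2 i3] eq[of i2 i4] eq[of i1 i2] eq[of i2 i2]
      eq[of i3 i3] eq[of i3 i4] eq[of i4 i3] eq[of i4 i4] d
    unfolding ents by simp_all
  \<comment> \<open>The off-diagonal block of \<open>N\<close>; the factor \<open>\<sigma>\<close>
    is the determinant of the 2-by-2 system with matrix S.\<close>
  have "\<sigma> * (\<delta> * n13 + (b1 - k*b3)) = 0" "\<sigma> * (\<delta> * n14 + (b2 - k*b4)) = 0"
    using e13 e14 n' \<sigma>_def by algebra+
  moreover have "\<sigma> * (\<delta> * n23 + (b3 - k*b1)) = 0" "\<sigma> * (\<delta> * n24 + (b4 - k*b2)) = 0"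
    using e23 e24 n' \<sigma>_def by algebra+
  ultimately have nb: "\<delta> * n13 = - (b1 - k*b3)" "\<delta> * n14 = - (b2 - k*b4)"
      "\<delta> * n23 = - (b3 - k*b1)" "\<delta> * n24 = - (b4 - k*b2)"
    using pos by auto
  \<comment> \<open>Two linear equations in \<open>m12\<close> and \<open>m22\<close>; eliminating
    \<open>m22\<close> gives the off-diagonal entry of \<open>K + B S B\<^sup>T\<close>.\<close>
  have m12a: "m12 - k * m22 = (b1 - k*b3) * (b3 + s*b4) + (b2 - k*b4) * (b4 + s*b3)"
    using e12 n' nb by algebra
  have m12b: "m22 - k * m12 = \<delta> + (b3 - k*b1) * (b3 + s*b4) + (b4 - k*b2) * (b4 + s*b3)"
    using e22 n' nb by algebra
  have "\<delta> * (m12 - (k + b1*b3 + s*(b1*b4 + b2*b3) + b2*b4)) = 0"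
    using m12a m12b \<delta>_def by algebra
  then have m12: "m12 = k + b1*b3 + s*(b1*b4 + b2*b3) + b2*b4"
    using pos by auto
  \<comment> \<open>Entries of \<open>A\<close> with the denominators \<open>\<delta>\<close> and
    \<open>\<sigma>\<close> cleared; the \<open>g\<close> carry the opposite sign.\<close>
  define A33 A44 A34 g13 g14 g23 g24 where gs:
    "A33 = \<delta> + \<sigma> * (b1^2 - 2*k*b1*b3 + b3^2)"
    "A44 = \<delta> + \<sigma> * (b2^2 - 2*k*b2*b4 + b4^2)"
    "A34 = s * (\<sigma> * (b1*b2 - k*(b1*b4 + b2*b3) + b3*b4) - s * \<delta>)"
    "g13 = (b1 + s*b2) * (b1 - k*b3)" "g14 = (b2 + s*b1) * (b2 - k*b4)"
    "g23 = (b3 + s*b4) * (b3 - k*b1)" "g24 = (b4 + s*b3) * (b4 - k*b2)"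
  have "\<sigma> * n33 = 1 - \<sigma> * (n13 * b1 + n23 * b3)"
    using e33 e43 e34 \<sigma>_def by algebra
  then have n33: "\<delta> * \<sigma> * n33 = A33"
    using nb gs(1) by algebra
  have "\<sigma> * n44 = 1 - \<sigma> * (n14 * b2 + n24 * b4)"
    using e44 e43 e34 \<sigma>_def by algebra
  then have n44: "\<delta> * \<sigma> * n44 = A44"
    using nb gs(2) by algebra
  have "\<sigma> * n34 = - s - \<sigma> * (n13 * b2 + n23 * b4)"
    using e33 e34 \<sigma>_def by algebra
  then have n34: "s * (\<delta> * \<sigma> * n34) = A34"
    using nb gs(3) by algebra
  have A: "A$i1$i2 = m12 * n12" "A$i1$i3 = (b1 + s*b2) * n13" "A$i1$i4 = (b2 + s*b1) * n14"
    "A$i2$i3 = (b3 + s*b4) * n23" "A$i2$i4 = (b4 + s*b3) * n24" "A$i3$i3 = n33" "A$i4$i4 = n44"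
    "A$i3$i4 = s * n34"
    unfolding A_def by (simp_all add: ents)
  have As: "\<delta> * A$i1$i2 = - (k * m12)" "\<delta> * A$i1$i3 = - g13" "\<delta> * A$i1$i4 = - g14"
    "\<delta> * A$i2$i3 = - g23" "\<delta> * A$i2$i4 = - g24"
    "\<delta> * \<sigma> * A$i3$i3 = A33" "\<delta> * \<sigma> * A$i4$i4 = A44" "\<delta> * \<sigma> * A$i3$i4 = A34"
    unfolding A using n' nb n33 n44 n34 gs by algebra+
  have "\<delta>^3 * \<sigma>^2 * ?C
    = - (\<delta> * A$i1$i2) * ((\<delta> * \<sigma> * A$i3$i3) * (\<delta> * \<sigma> * A$i4$i4) - (\<delta> * \<sigma> * A$i3$i4)^2)
      + \<sigma> * ((\<delta> * A$i1$i3) * (\<delta> * A$i2$i3) * (\<delta> * \<sigma> * A$i4$i4)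
        + (\<delta> * A$i1$i4) * (\<delta> * A$i2$i4) * (\<delta> * \<sigma> * A$i3$i3)
        - (\<delta> * \<sigma> * A$i3$i4) * ((\<delta> * A$i1$i3) * (\<delta> * A$i2$i4) + (\<delta> * A$i1$i4) * (\<delta> * A$i2$i3)))"
    by algebra
  also have "\<dots> = k * m12 * (A33 * A44 - A34^2)
      + \<sigma> * (g13*g23*A44 + g14*g24*A33 - A34*(g13*g24 + g14*g23))"
    unfolding As by algebra
  also have "\<dots> \<ge> 0"
    unfolding m12 using cofactor_polynomial_nonneg[OF k s[folded s_def] \<delta>_def \<sigma>_def gs] .
  finally show ?thesis
    using pos mult_pos_neg[of "\<delta>^3 * \<sigma>^2" ?C] by (meson linorder_not_le mult_pos_pos zero_less_power)
qed

text \<open>\<open>M * matrix_inv M\<close> is unchanged by replacing \<open>M\<close> with \<open>D M D\<close>, \<open>D\<close> diagonal.\<close>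
lemma cofactor_nonneg:
  fixes M :: "real^'n^'n"
  defines "A \<equiv> M * matrix_inv M"
  assumes M: "positive_definite M"
    and U: "UNIV = {i1, i2, i3, i4}" and dist: "distinct [i1, i2, i3, i4]"
  shows "0 \<le> - A$i1$i2 * (A$i3$i3 * A$i4$i4 - (A$i3$i4)^2)
    + A$i1$i3 * A$i2$i3 * A$i4$i4 + A$i1$i4 * A$i2$i4 * A$i3$i3
    - A$i3$i4 * (A$i1$i3 * A$i2$i4 + A$i1$i4 * A$i2$i3)"
proof -
  define N where "N = matrix_inv M"
  have N: "positive_definite N" using positive_definite_matrix_inv[OF M] by (simp add: N_def)
  have NM: "N ** M = mat 1" using matrix_inv_mult[OF positive_definite_invertible[OF M]] by (simp add: N_def)
  have ne: "i1 \<noteq> i2" "i1 \<noteq> i3" "i1 \<noteq> i4" "i2 \<noteq> i3" "i2 \<noteq> i4" "i3 \<noteq> i4" using dist by auto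
  define n1 n2 where n12: "n1 = sqrt (N$i1$i1)" "n2 = sqrt (N$i2$i2)"
  have npos: "0 < n1" "0 < n2" and nsq: "n1^2 = N$i1$i1" "n2^2 = N$i2$i2"
    using positive_definite_diag_pos[OF N] by (simp_all add: n12 less_imp_le)
  \<comment> \<open>Inverting a 2-by-2 block flips the sign of its off-diagonal entry, and
    \<open>k\<close> is to be an entry of K, not of its inverse.\<close>
  define k where "k = - N$i1$i2 / (n1 * n2)"
  have k: "k^2 < 1"
    using positive_definite_minor_pos[OF N ne(1)] positive_definite_diag_pos[OF N]
    by (simp add: k_def power_divide power_mult_distrib nsq)
  \<comment> \<open>Chosen so that \<open>N'\<close> has the block
    \<open>(1, -k; -k, 1) / (1 - k^2)\<close> on \<open>i1, i2\<close>, and \<open>M'\<close> has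
    unit diagonal at \<open>i3\<close> and \<open>i4\<close>.\<close>
  define d where "d p = (if p = i1 then n1 * sqrt (1 - k^2) else if p = i2 then n2 * sqrt (1 - k^2)
    else 1 / sqrt (M$p$p))" for p
  have d: "0 < d p" for p using npos k positive_definite_diag_pos[OF M] by (auto simp: d_def)
  have d0: "d p \<noteq> 0" for p using d[of p] by simp
  define M' :: "real^'n^'n" where "M' = (\<chi> p q. d p * d q * M$p$q)"
  define N' :: "real^'n^'n" where "N' = (\<chi> p q. N$p$q / (d p * d q))"
  have A: "A = M' * N'" by (simp add: A_def M'_def N'_def N_def[symmetric] vec_eq_iff d0)
  have NM': "N' ** M' = mat 1"
  proof -
    have "(N' ** M')$p$q = d q / d p * (N ** M)$p$q" for p q
      by (simp add: matrix_matrix_mult_def N'_def M'_def sum_distrib_left d0 mult_ac)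
    then show ?thesis by (simp add: NM mat_def vec_eq_iff d0)
  qed
  have d2: "d i3 * d i3 * M$i3$i3 = 1" "d i4 * d i4 * M$i4$i4 = 1"
    using ne positive_definite_diag_pos[OF M, of i3] positive_definite_diag_pos[OF M, of i4]
    by (simp_all add: d_def)
  have "d i1 * d i1 = (1 - k^2) * N$i1$i1" "d i2 * d i2 = (1 - k^2) * N$i2$i2"
    "d i1 * d i2 = (1 - k^2) * (n1 * n2)"
    using ne k by (simp_all add: d_def nsq[symmetric] power2_eq_square[of n1] power2_eq_square[of n2])
  then have n': "(1 - k^2) * N'$i1$i1 = 1" "(1 - k^2) * N'$i2$i2 = 1" "(1 - k^2) * N'$i1$i2 = - k"
    using k positive_definite_diag_pos[OF N] by (auto simp: N'_def k_def less_le)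
  have "(M'$i3$i4)^2 = (d i3 * d i3) * (d i4 * d i4) * (M$i3$i4)^2"
    by (simp add: M'_def power2_eq_square)
  also have "\<dots> < (d i3 * d i3) * (d i4 * d i4) * (M$i3$i3 * M$i4$i4)"
    using positive_definite_minor_pos[OF M ne(6)] d by (intro mult_strict_left_mono) auto
  also have "\<dots> = (d i3 * d i3 * M$i3$i3) * (d i4 * d i4 * M$i4$i4)" by simp
  finally have s: "(M'$i3$i4)^2 < 1" by (simp only: d2)
  have sym: "transpose M' = M'" "transpose N' = N'"
    using positive_definite_sym[OF M] positive_definite_sym[OF N]
    by (auto simp: M'_def N'_def transpose_def vec_eq_iff)
  show ?thesis
    unfolding A
    by (rule normalised_cofactor_nonneg[OF U dist sym NM' k s n'])
       (simp_all add: M'_def d2)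
qed

text \<open>Cramer's rule for the principal submatrix of \<open>A\<close> on \<open>i1, i3, i4\<close>: the vector \<open>x\<close> below
  is supported there and \<open>A x\<close> vanishes at \<open>i3\<close> and \<open>i4\<close>.\<close>
lemma inverse_entry_nonneg:
  fixes A B :: "real^'n^'n"
  assumes A: "positive_definite A" and B: "positive_definite B" and AB: "A ** B = mat 1"
    and U: "UNIV = {i1, i2, i3, i4}" and dist: "distinct [i1, i2, i3, i4]"
    and C: "0 \<le> - A$i1$i2 * (A$i3$i3 * A$i4$i4 - (A$i3$i4)^2)
    + A$i1$i3 * A$i2$i3 * A$i4$i4 + A$i1$i4 * A$i2$i4 * A$i3$i3
    - A$i3$i4 * (A$i1$i3 * A$i2$i4 + A$i1$i4 * A$i2$i3)" (is "0 \<le> ?C")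
  shows "0 \<le> B$i1$i2"
proof -
  have ne: "i1 \<noteq> i2" "i1 \<noteq> i3" "i1 \<noteq> i4" "i2 \<noteq> i3" "i2 \<noteq> i4" "i3 \<noteq> i4" using dist by auto
  note sym = positive_definite_sym[OF A]
  define \<Delta> where "\<Delta> = A$i3$i3 * A$i4$i4 - (A$i3$i4)^2"
  define y3 where "y3 = A$i3$i4 * A$i1$i4 - A$i4$i4 * A$i1$i3"
  define y4 where "y4 = A$i3$i4 * A$i1$i3 - A$i3$i3 * A$i1$i4"
  \<comment> \<open>The determinant of the principal submatrix on \<open>i1, i3, i4\<close>, which
    is also the entry of \<open>A *v x\<close> at \<open>i1\<close>; hence the form at
    \<open>x\<close> equals \<open>\<Delta> * D\<close>.\<close>
  define D where "D = \<Delta> * A$i1$i1 + y3 * A$i1$i3 + y4 * A$i1$i4"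
  have \<Delta>: "0 < \<Delta>" using positive_definite_minor_pos[OF A ne(6)] by (simp add: \<Delta>_def)
  define x :: "real^'n" where "x = (\<chi> p. if p = i1 then \<Delta> else if p = i3 then y3 else if p = i4 then y4 else 0)"
  have x: "x$i1 = \<Delta>" "x$i2 = 0" "x$i3 = y3" "x$i4 = y4" using ne by (auto simp: x_def)
  have "x \<noteq> 0" using x(1) \<Delta> by auto
  then have "0 < x \<bullet> (A *v x)" using A unfolding positive_definite_def by blast
  also have "x \<bullet> (A *v x) = A$i1$i1 * \<Delta>^2 + A$i3$i3 * y3^2 + A$i4$i4 * y4^2
      + 2 * (A$i1$i3 * \<Delta> * y3 + A$i1$i4 * \<Delta> * y4 + A$i3$i4 * y3 * y4)"
    using ne unfolding inner_matrix_vector_mult U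
    by (simp add: x sym[of i3 i1] sym[of i4 i1] sym[of i4 i3] power2_eq_square algebra_simps)
  also have "\<dots> = \<Delta> * D"
    unfolding y3_def y4_def \<Delta>_def D_def by algebra
  finally have D: "0 < D" using \<Delta> by (simp add: zero_less_mult_iff)
  have row: "A$p$i1 * B$i1$i2 + A$p$i2 * B$i2$i2 + A$p$i3 * B$i3$i2 + A$p$i4 * B$i4$i2
      = (if p = i2 then 1 else 0)" for p
  proof -
    have "(A ** B)$p$i2 = A$p$i1 * B$i1$i2 + A$p$i2 * B$i2$i2 + A$p$i3 * B$i3$i2 + A$p$i4 * B$i4$i2"
      using ne by (simp add: matrix_matrix_mult_def U)
    then show ?thesis by (simp add: AB mat_def)
  qed
  have "A$i1$i1 * B$i1$i2 + A$i1$i2 * B$i2$i2 + A$i1$i3 * B$i3$i2 + A$i1$i4 * B$i4$i2 = 0"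
    "A$i1$i3 * B$i1$i2 + A$i2$i3 * B$i2$i2 + A$i3$i3 * B$i3$i2 + A$i3$i4 * B$i4$i2 = 0"
    "A$i1$i4 * B$i1$i2 + A$i2$i4 * B$i2$i2 + A$i3$i4 * B$i3$i2 + A$i4$i4 * B$i4$i2 = 0"
    using row[of i1] row[of i3] row[of i4] ne
    by (simp_all add: sym[of i3 i1] sym[of i4 i1] sym[of i4 i3] sym[of i3 i2] sym[of i4 i2])
  \<comment> \<open>Weighting the three equations by \<open>\<Delta>\<close>, \<open>y3\<close>,
    \<open>y4\<close> cancels \<open>B$i3$i2\<close> and \<open>B$i4$i2\<close>.\<close>
  then have "D * B$i1$i2 = ?C * B$i2$i2"
    unfolding D_def \<Delta>_def y3_def y4_def by algebra
  then have "0 \<le> D * B$i1$i2"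
    using C positive_definite_diag_pos[OF B, of i2] by (simp add: less_imp_le)
  then show ?thesis using D by (simp add: zero_le_mult_iff)
qed

section \<open>The inverse relative gain array of a positive definite matrix\<close>

lemma positive_definite_RGA:
  assumes "positive_definite M"
  shows "positive_definite (RGA M)" "RGA M = M * matrix_inv M"
proof -
  note N = positive_definite_matrix_inv[OF assms]
  show "RGA M = M * matrix_inv M"
    using N by (simp add: RGA_def positive_definite_def)
  then show "positive_definite (RGA M)" using schur_product[OF assms N] by simp
qed

lemma positive_definite_IRGA:
  "positive_definite M \<Longrightarrow> positive_definite (IRGA M)"
  unfolding IRGA_def by (intro positive_definite_matrix_inv positive_definite_RGA)

lemma RGA_mult_IRGA:
  assumes "positive_definite M"
  shows "RGA M ** IRGA M = mat 1"
  unfolding IRGA_def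
  using assms by (intro matrix_inv_mult positive_definite_invertible positive_definite_RGA)

text \<open>The all-ones vector \<open>1\<close> is fixed by \<open>RGA M\<close>, hence by its
  inverse.\<close>

lemma IRGA_unit_row_sums:
  assumes M: "positive_definite M"
  shows "(\<Sum>j\<in>UNIV. IRGA M $ i $ j) = 1"
proof -
  note inv = matrix_inv_mult[OF positive_definite_invertible[OF M]]
  have "(\<Sum>j\<in>UNIV. RGA M $ i $ j) = (M ** matrix_inv M) $ i $ i" for i
    by (simp add: RGA_def transpose_def matrix_matrix_mult_def)
  then have "RGA M *v 1 = 1"
    by (simp add: inv mat_def matrix_vector_mult_def vec_eq_iff)
  moreover have "IRGA M ** RGA M = mat 1"
    unfolding IRGA_def by (intro matrix_inv_mult positive_definite_invertible positive_definite_RGA M)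
  ultimately have "IRGA M *v 1 = 1"
    by (metis matrix_vector_mul_assoc matrix_vector_mul_lid)
  then show ?thesis by (simp add: matrix_vector_mult_def vec_eq_iff)
qed

text \<open>For an off-diagonal entry, \<open>i, j\<close> take the roles of \<open>i1, i2\<close>
  in the cofactor inequality and the two remaining indices those of \<open>i3, i4\<close>.\<close>

lemma IRGA_entry_nonneg_card_4:
  fixes M :: "real^'n^'n"
  assumes M: "positive_definite M" and card: "CARD('n) = 4"
  shows "0 \<le> IRGA M $ i $ j"
proof (cases "i = j")
  case True
  then show ?thesis
    using positive_definite_diag_pos[OF positive_definite_IRGA[OF M]] by (simp add: less_imp_le)
next
  case False
  then have "card (UNIV - {i, j}) = 2" using card by (simp add: card_Diff_subset)
  then obtain k l where kl: "UNIV - {i, j} = {k, l}" "k \<noteq> l" by (auto simp: card_2_iff)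
  then have ijkl: "UNIV = {i, j, k, l}" "distinct [i, j, k, l]" using False by auto
  show ?thesis
    using cofactor_nonneg[OF M ijkl] unfolding positive_definite_RGA(2)[OF M, symmetric]
    by (rule inverse_entry_nonneg[OF positive_definite_RGA(1)[OF M] positive_definite_IRGA[OF M]
          RGA_mult_IRGA[OF M] ijkl])
qed

section \<open>Adding an identity block\<close>

text \<open>The block diagonal matrix of \<open>M\<close> and an identity, with \<open>f\<close>
  placing the indices of \<open>M\<close>. Sizes are types, so enlarging a matrix means changing its
  index type.\<close>

definition pad :: "('n \<Rightarrow> 'm) \<Rightarrow> real^'n^'n \<Rightarrow> real^'m^'m" where
  "pad f M = (\<chi> p q. if p \<in> range f \<and> q \<in> range f then M $ inv f p $ inv f q
     else if p = q then 1 else 0)"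

context
  fixes f :: "'n::finite \<Rightarrow> 'm::finite"
  assumes f: "inj f"
begin

lemma pad_nth: "pad f M $ f i $ f j = M $ i $ j"
  by (simp add: pad_def f)

lemma sum_range_split:
  fixes g :: "'m \<Rightarrow> real"
  shows "sum g UNIV = (\<Sum>i\<in>UNIV. g (f i)) + sum g (- range f)"
proof -
  have "sum g UNIV = sum g (range f) + sum g (- range f)"
    by (metis Compl_partition Compl_disjoint finite sum.union_disjoint)
  then show ?thesis using f by (simp add: sum.reindex)
qed

lemma pad_mult: "pad f A ** pad f B = pad f (A ** B)"
proof -
  have "(\<Sum>r\<in>UNIV. pad f A $ p $ r * pad f B $ r $ q) = pad f (A ** B) $ p $ q" for p q
  proof (cases "p \<in> range f")
    case True
    then obtain p' where p: "p = f p'" by blast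
    have "(\<Sum>r\<in>- range f. pad f A $ p $ r * pad f B $ r $ q) = 0"
      using True by (intro sum.neutral) (auto simp: pad_def)
    then have split: "(\<Sum>r\<in>UNIV. pad f A $ p $ r * pad f B $ r $ q)
        = (\<Sum>r\<in>UNIV. A $ p' $ r * pad f B $ f r $ q)"
      by (subst sum_range_split) (simp add: p pad_nth)
    show ?thesis
    proof (cases "q \<in> range f")
      case True
      then show ?thesis unfolding split by (auto simp: p pad_nth matrix_matrix_mult_def)
    next
      case False
      then have "pad f B $ f r $ q = 0" for r by (auto simp: pad_def)
      moreover have "pad f (A ** B) $ p $ q = 0" using False p by (auto simp: pad_def)
      ultimately show ?thesis unfolding split by simp
    qed
  next
    case False
    then have "(\<Sum>r\<in>UNIV. pad f A $ p $ r * pad f B $ r $ q) = (\<Sum>r\<in>UNIV. if r = p then pad f B $ p $ q else 0)"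
      by (intro sum.cong) (auto simp: pad_def)
    also have "\<dots> = pad f (A ** B) $ p $ q" using False by (simp add: pad_def)
    finally show ?thesis .
  qed
  then show ?thesis by (simp add: matrix_matrix_mult_def vec_eq_iff)
qed

lemma pad_mat_1: "pad f (mat 1) = mat 1"
  by (auto simp: pad_def mat_def vec_eq_iff f)

lemma pad_matrix_inv:
  assumes "invertible M"
  shows "matrix_inv (pad f M) = pad f (matrix_inv M)"
  using assms by (intro matrix_inv_eq) (simp add: pad_mult matrix_inv_mult pad_mat_1)

lemma pad_transpose: "transpose (pad f M) = pad f (transpose M)"
  by (auto simp: pad_def transpose_def vec_eq_iff)

text \<open>The identity block is idempotent under the entrywise product as well as the matrix
  product; this is why padding commutes with the relative gain array.\<close>

lemma pad_hadamard: "pad f A * pad f B = pad f (A * B)"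
  by (auto simp: pad_def vec_eq_iff)

text \<open>The form splits into that of \<open>M\<close> at the restriction \<open>y\<close> and a
  sum of squares outside the range of \<open>f\<close>; a nonzero \<open>x\<close> makes one of the
  two positive.\<close>

lemma positive_definite_pad:
  assumes M: "positive_definite M"
  shows "positive_definite (pad f M)"
  unfolding positive_definite_def
proof (intro conjI allI impI)
  show "transpose (pad f M) = pad f M"
    using M by (simp add: pad_transpose positive_definite_def)
  fix x :: "real^'m" assume x: "x \<noteq> 0"
  define y :: "real^'n" where "y = (\<chi> i. x $ f i)"
  have rows: "(\<Sum>q\<in>UNIV. pad f M $ p $ q * x $ p * x $ q)
      = (if p \<in> range f then y $ inv f p * (\<Sum>j\<in>UNIV. M $ inv f p $ j * y $ j) else (x $ p)^2)" for p
  proof (cases "p \<in> range f")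
    case True
    then have "(\<Sum>r\<in>- range f. pad f M $ p $ r * x $ p * x $ r) = 0"
      by (intro sum.neutral) (auto simp: pad_def)
    then have "(\<Sum>q\<in>UNIV. pad f M $ p $ q * x $ p * x $ q) = (\<Sum>j\<in>UNIV. pad f M $ p $ f j * x $ p * x $ f j)"
      by (subst sum_range_split) simp
    with True show ?thesis
      by (auto simp: pad_nth f y_def sum_distrib_left mult_ac)
  next
    case False
    then have "(\<Sum>q\<in>UNIV. pad f M $ p $ q * x $ p * x $ q) = (\<Sum>q\<in>UNIV. if q = p then (x $ p)^2 else 0)"
      by (intro sum.cong) (auto simp: pad_def power2_eq_square)
    with False show ?thesis by simp
  qed
  have "x \<bullet> (pad f M *v x) = y \<bullet> (M *v y) + (\<Sum>p\<in>- range f. (x $ p)^2)"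
    unfolding inner_matrix_vector_mult rows
    by (subst sum_range_split) (simp add: f sum_distrib_left mult_ac)
  also have "\<dots> > 0"
  proof (cases "y = 0")
    case False
    then have "0 < y \<bullet> (M *v y)" using M unfolding positive_definite_def by blast
    then show ?thesis by (simp add: add_pos_nonneg sum_nonneg)
  next
    case True
    obtain p where p: "x $ p \<noteq> 0" using x by (auto simp: vec_eq_iff)
    have "p \<in> - range f" using p True by (auto simp: y_def vec_eq_iff)
    then have "0 < (\<Sum>p\<in>- range f. (x $ p)^2)"
      using p by (intro sum_pos2[of _ p]) auto
    then show ?thesis by (simp add: True)
  qed
  finally show "0 < x \<bullet> (pad f M *v x)" .
qed

lemma RGA_pad:
  assumes "positive_definite M"
  shows "RGA (pad f M) = pad f (RGA M)"
  using positive_definite_invertible[OF assms]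
  by (simp add: RGA_def pad_matrix_inv pad_transpose pad_hadamard)

lemma IRGA_pad:
  assumes "positive_definite M"
  shows "IRGA (pad f M) = pad f (IRGA M)"
  using positive_definite_invertible[OF positive_definite_RGA(1)[OF assms]]
  by (simp add: IRGA_def RGA_pad[OF assms] pad_matrix_inv)

end

lemma IRGA_entry_nonneg:
  fixes M :: "real^'n^'n"
  assumes M: "positive_definite M" and card: "CARD('n) \<le> 4"
  shows "0 \<le> IRGA M $ i $ j"
proof -
  obtain f :: "'n \<Rightarrow> 4" where f: "inj f"
    using card card_le_inj[of "UNIV :: 'n set" "UNIV :: 4 set"] by auto
  have "0 \<le> IRGA (pad f M) $ f i $ f j"
    by (rule IRGA_entry_nonneg_card_4[OF positive_definite_pad[OF f M]]) simp
  then show ?thesis by (simp add: IRGA_pad[OF f M] pad_nth[OF f])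
qed

section \<open>Row and column permutations\<close>

definition rearrange :: "('n \<Rightarrow> 'n) \<Rightarrow> ('n \<Rightarrow> 'n) \<Rightarrow> real^'n^'n \<Rightarrow> real^'n^'n" where
  "rearrange \<pi> \<rho> M = (\<chi> i j. M $ \<pi> i $ \<rho> j)"

text \<open>The right factor has its 1 of row \<open>r\<close> in column \<open>\<rho> r\<close>, so
  column \<open>j\<close> of the product is read from column \<open>inv \<rho> j\<close>.\<close>

lemma permutation_matrix_mult:
  fixes M :: "real^'n^'n"
  assumes "bij \<rho>"
  shows "(\<chi> i j. if j = \<pi> i then 1 else 0) ** M ** (\<chi> i j. if j = \<rho> i then 1 else 0)
    = rearrange \<pi> (inv \<rho>) M"
proof -
  have "(j = \<rho> r) = (r = inv \<rho> j)" for r j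
    using assms by (metis bij_inv_eq_iff)
  then show ?thesis
    by (simp add: matrix_matrix_mult_def rearrange_def vec_eq_iff if_distrib if_distribR cong: if_cong)
qed

lemma up_to_permutations_iff:
  "up_to_permutations \<Phi> M \<longleftrightarrow> (\<exists>\<pi> \<rho>. bij \<pi> \<and> bij \<rho> \<and> \<Phi> (rearrange \<pi> \<rho> M))"
proof
  assume "up_to_permutations \<Phi> M"
  then obtain \<pi> \<rho> where "\<pi> permutes UNIV" "\<rho> permutes UNIV"
    "\<Phi> ((\<chi> i j. if j = \<pi> i then 1 else 0) ** M ** (\<chi> i j. if j = \<rho> i then 1 else 0))"
    unfolding up_to_permutations_def permutation_matrix_def by blast
  then show "\<exists>\<pi> \<rho>. bij \<pi> \<and> bij \<rho> \<and> \<Phi> (rearrange \<pi> \<rho> M)"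
    using permutation_matrix_mult[of \<rho> \<pi> M] by (metis bij_imp_bij_inv permutes_bij)
next
  assume "\<exists>\<pi> \<rho>. bij \<pi> \<and> bij \<rho> \<and> \<Phi> (rearrange \<pi> \<rho> M)"
  then obtain \<pi> \<rho> where "bij \<pi>" "bij \<rho>" "\<Phi> (rearrange \<pi> \<rho> M)" by blast
  moreover have "rearrange \<pi> \<rho> M
      = (\<chi> i j. if j = \<pi> i then 1 else 0) ** M ** (\<chi> i j. if j = inv \<rho> i then 1 else 0)"
    using \<open>bij \<rho>\<close> by (simp add: permutation_matrix_mult bij_imp_bij_inv inv_inv_eq)
  moreover have "\<pi> permutes UNIV" "inv \<rho> permutes UNIV"
    using \<open>bij \<pi>\<close> \<open>bij \<rho>\<close> by (auto intro: bij_imp_permutes bij_imp_bij_inv)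
  ultimately show "up_to_permutations \<Phi> M"
    unfolding up_to_permutations_def permutation_matrix_def by metis
qed

lemma rearrange_mult:
  assumes "bij \<rho>"
  shows "rearrange \<pi> \<rho> A ** rearrange \<rho> \<tau> B = rearrange \<pi> \<tau> (A ** B)"
  using sum.reindex_bij_betw[OF assms, of "\<lambda>k. A $ i $ k * B $ k $ j" for i j]
  by (simp add: rearrange_def matrix_matrix_mult_def vec_eq_iff)

lemma rearrange_mat_1: "bij \<pi> \<Longrightarrow> rearrange \<pi> \<pi> (mat 1) = mat 1"
  by (auto simp: rearrange_def mat_def vec_eq_iff dest: bij_is_inj injD)

lemma rearrange_inv:
  "bij \<pi> \<Longrightarrow> bij \<rho> \<Longrightarrow> rearrange (inv \<pi>) (inv \<rho>) (rearrange \<pi> \<rho> M) = M"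
  by (simp add: rearrange_def vec_eq_iff bij_is_surj surj_f_inv_f)

lemma rearrange_invertible:
  assumes "bij \<pi>" "bij \<rho>" "invertible M"
  shows "invertible (rearrange \<pi> \<rho> M)"
    "matrix_inv (rearrange \<pi> \<rho> M) = rearrange \<rho> \<pi> (matrix_inv M)"
proof -
  have eq: "rearrange \<pi> \<rho> M ** rearrange \<rho> \<pi> (matrix_inv M) = mat 1"
    using assms by (simp add: rearrange_mult matrix_inv_mult rearrange_mat_1)
  then show "matrix_inv (rearrange \<pi> \<rho> M) = rearrange \<rho> \<pi> (matrix_inv M)" by (rule matrix_inv_eq)
  show "invertible (rearrange \<pi> \<rho> M)" using eq invertible_right_inverse by blast
qed

text \<open>Inversion exchanges the row and column permutations, and the transpose exchanges them
  back.\<close>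

lemma RGA_rearrange:
  assumes "bij \<pi>" "bij \<rho>" "invertible M"
  shows "RGA (rearrange \<pi> \<rho> M) = rearrange \<pi> \<rho> (RGA M)"
  unfolding RGA_def rearrange_invertible(2)[OF assms]
  by (simp add: rearrange_def transpose_def vec_eq_iff)

theorem theorem2:
  fixes G :: "real^'n^'n"
  assumes "up_to_permutations positive_definite G"
  shows "invertible G \<and> invertible (RGA G)
    \<and> up_to_permutations positive_definite (IRGA G)
    \<and> unit_row_sums (IRGA G) \<and> unit_col_sums (IRGA G)
    \<and> (CARD('n) \<le> 4 \<longrightarrow>
         entrywise_nonneg (IRGA G)
         \<and> doubly_stochastic (IRGA G)
         \<and> up_to_permutations doubly_nonnegative (IRGA G))"
proof -
  obtain \<pi> \<rho> where bij: "bij \<pi>" "bij \<rho>" and "positive_definite (rearrange \<pi> \<rho> G)"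
    using assms unfolding up_to_permutations_iff by blast
  define M where "M = rearrange \<pi> \<rho> G"
  have M: "positive_definite M" unfolding M_def by fact
  have G: "G = rearrange (inv \<pi>) (inv \<rho>) M" using bij by (simp add: M_def rearrange_inv)
  note bij' = bij[THEN bij_imp_bij_inv]
  note inv = positive_definite_invertible[OF M] positive_definite_invertible[OF positive_definite_RGA(1)[OF M]]
  have RGA: "RGA G = rearrange (inv \<pi>) (inv \<rho>) (RGA M)"
    unfolding G by (rule RGA_rearrange[OF bij' inv(1)])
  \<comment> \<open>No transpose follows this inversion, so the two permutations stay
    exchanged.\<close>
  have IRGA: "IRGA G = rearrange (inv \<rho>) (inv \<pi>) (IRGA M)"
    unfolding IRGA_def RGA by (rule rearrange_invertible(2)[OF bij' inv(2)])
  have IRGA_M: "rearrange \<rho> \<pi> (IRGA G) = IRGA M"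
    unfolding IRGA using rearrange_inv[OF bij'(2,1)] bij by (simp add: inv_inv_eq)
  have rows: "unit_row_sums (IRGA G)"
    unfolding unit_row_sums_def IRGA rearrange_def
    using sum.reindex_bij_betw[OF bij'(1), of "\<lambda>j. IRGA M $ i $ j" for i] by (simp add: IRGA_unit_row_sums[OF M])
  \<comment> \<open>Symmetry of \<open>IRGA M\<close> turns its row sums into column sums.\<close>
  have cols: "unit_col_sums (IRGA G)"
    unfolding unit_col_sums_def IRGA rearrange_def
    using sum.reindex_bij_betw[OF bij'(2), of "\<lambda>i. IRGA M $ i $ j" for j]
      positive_definite_sym[OF positive_definite_IRGA[OF M]]
    by (simp add: IRGA_unit_row_sums[OF M])
  have nonneg: "entrywise_nonneg (IRGA M)" "entrywise_nonneg (IRGA G)" if "CARD('n) \<le> 4"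
    using IRGA_entry_nonneg[OF M that] by (simp_all add: entrywise_nonneg_def IRGA rearrange_def)
  have "invertible G" "invertible (RGA G)"
    unfolding RGA using rearrange_invertible(1)[OF bij'] inv by (simp_all add: G)
  moreover have "up_to_permutations positive_definite (IRGA G)"
    unfolding up_to_permutations_iff using bij IRGA_M positive_definite_IRGA[OF M] by metis
  moreover have "up_to_permutations doubly_nonnegative (IRGA G)" if "CARD('n) \<le> 4"
    unfolding up_to_permutations_iff doubly_nonnegative_def
    using bij IRGA_M positive_definite_IRGA[OF M] nonneg(1)[OF that] by metis
  ultimately show ?thesis
    using rows cols nonneg(2) by (simp add: doubly_stochastic_def)
qed

end
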